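(* Let $0<\gamma<2$. For every $\varepsilon>0$ let $u_0=u_0^\varepsilon,\ u_1=u_1^\varepsilon\in\mathcal A_\varepsilon$ be such that $u_1$ is a minimizer of $\mathcal F_\varepsilon^{\tau,\gamma}(\cdot,u_0)$, and set $C_\varepsilon=\#Z_0^\varepsilon$. Then there exists $\bar\varepsilon>0$ such that $\#Z_1^\varepsilon=C_\varepsilon$ for every $\varepsilon\le\bar\varepsilon$.
   Context: Fix $k\in(1/3,1)$, $\zeta>0$; for $\varepsilon>0$ let $\tau=\zeta\varepsilon$. $\mathcal A_\varepsilon$ is the set of functions $u:\varepsilon\mathbb Z^2\to\{-1,0,1\}$ with $\#\{p:u(p)=0\}<\infty$. For $u\in\mathcal A_\varepsilon$, $$\mathcal E_\varepsilon(u)=\sum\varepsilon\big(1-u(p)u(q)-k(1-(u(p)u(q))^2)\big),$$ the sum being over unordered pairs $\{p,q\}\subset\varepsilon\mathbb Z^2$ with $|p-q|=\varepsilon$. Put $I_u=\{u=1\}$, $Z_u=\{u=0\}$, $Z_j^\varepsilon=Z_{u_j^\varepsilon}$. For $I\subset\varepsilon\mathbb Z^2$, $d_1^\varepsilon(p,\partial I)=\inf\{\|p-q\|_1:q\in I\}$ if $p\notin I$, and $=\inf\{\|p-q\|_1:q\in\varepsilon\mathbb Z^2\setminus I\}$ if $p\in I$. For $u,w\in\mathcal A_\varepsilon$, $$\mathcal F_\varepsilon^{\tau,\gamma}(u,w)=\mathcal E_\varepsilon(u)+\frac1\tau\Big(\sum_{p\in I_u\triangle I_w}\varepsilon^2d_1^\varepsilon(p,\partial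 I_w)+\varepsilon^\gamma|\#Z_u-\#Z_w|\Big).$$ The functional is regarded as real-valued: a minimizer $u_1$ of $\mathcal F_\varepsilon^{\tau,\gamma}(\cdot,u_0)$ is an element of $\mathcal A_\varepsilon$ with $\mathcal F_\varepsilon^{\tau,\gamma}(u_1,u_0)<+\infty$ and $\mathcal F_\varepsilon^{\tau,\gamma}(u_1,u_0)\le\mathcal F_\varepsilon^{\tau,\gamma}(u,u_0)$ for all $u\in\mathcal A_\varepsilon$. *)

theory Defs
  imports "HOL-Analysis.Analysis"
begin

definition lattice2 :: "real \<Rightarrow> (real \<times> real) set" where
  "lattice2 \<epsilon> = {(\<epsilon> * of_int i, \<epsilon> * of_int j) | i j :: int. True}"

definition phase_I :: "real \<Rightarrow> (real \<times> real \<Rightarrow> real) \<Rightarrow> (real \<times> real) set" where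
  "phase_I \<epsilon> u = {p \<in> lattice2 \<epsilon>. u p = 1}"

definition phase_Z :: "real \<Rightarrow> (real \<times> real \<Rightarrow> real) \<Rightarrow> (real \<times> real) set" where
  "phase_Z \<epsilon> u = {p \<in> lattice2 \<epsilon>. u p = 0}"

text \<open>Functions on the lattice are total functions on the plane that are
  \<open>undefined\<close> off the lattice.\<close>

definition admissible :: "real \<Rightarrow> (real \<times> real \<Rightarrow> real) set" where
  "admissible \<epsilon> = {u \<in> lattice2 \<epsilon> \<rightarrow>\<^sub>E {-1, 0, 1}. finite (phase_Z \<epsilon> u)}"

definition bonds :: "real \<Rightarrow> (real \<times> real) set set" where
  "bonds \<epsilon> = {{p, q} | p q. p \<in> lattice2 \<epsilon> \<and> q \<in> lattice2 \<epsilon> \<and> dist p q = \<epsilon>}"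

text \<open>For a bond \<open>e = {p, q}\<close> with \<open>p \<noteq> q\<close>, the product of \<open>u\<close> over \<open>e\<close> is \<open>u p * u q\<close>.
  It lies in \<open>{-1, 0, 1}\<close>, so the bond energy is \<open>2 * \<epsilon>\<close>, \<open>(1 - k) * \<epsilon>\<close> or \<open>0\<close>.
  For \<open>\<epsilon> > 0\<close> and \<open>k \<le> 1\<close> it is therefore nonnegative, and \<open>ennreal\<close> truncates nothing.
  The sum over the infinitely many bonds may be \<open>\<infinity>\<close>.\<close>

definition energy :: "real \<Rightarrow> real \<Rightarrow> (real \<times> real \<Rightarrow> real) \<Rightarrow> ennreal" where
  "energy k \<epsilon> u = (\<Sum>\<^sub>\<infinity>e\<in>bonds \<epsilon>.
     ennreal (\<epsilon> * (1 - (\<Prod>p\<in>e. u p) - k * (1 - (\<Prod>p\<in>e. u p)\<^sup>2))))"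

definition dist_l1 :: "real \<times> real \<Rightarrow> real \<times> real \<Rightarrow> real" where
  "dist_l1 p q = \<bar>fst p - fst q\<bar> + \<bar>snd p - snd q\<bar>"

text \<open>The infimum over the empty set is \<open>\<infinity>\<close>; this happens for \<open>I = {}\<close> and for
  \<open>I = lattice2 \<epsilon>\<close>.\<close>

definition dist_bdry :: "real \<Rightarrow> real \<times> real \<Rightarrow> (real \<times> real) set \<Rightarrow> ennreal" where
  "dist_bdry \<epsilon> p I =
     (if p \<in> I then (INF q\<in>lattice2 \<epsilon> - I. ennreal (dist_l1 p q))
      else (INF q\<in>I. ennreal (dist_l1 p q)))"

definition functional_F ::
  "real \<Rightarrow> real \<Rightarrow> real \<Rightarrow> real \<Rightarrow> (real \<times> real \<Rightarrow> real) \<Rightarrow> (real \<times> real \<Rightarrow> real) \<Rightarrow> ennreal" where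
  "functional_F k \<tau> \<gamma> \<epsilon> u w = energy k \<epsilon> u + ennreal (1 / \<tau>) *
     ((\<Sum>\<^sub>\<infinity>p\<in>sym_diff (phase_I \<epsilon> u) (phase_I \<epsilon> w).
         ennreal (\<epsilon>\<^sup>2) * dist_bdry \<epsilon> p (phase_I \<epsilon> w))
      + ennreal (\<epsilon> powr \<gamma> * \<bar>real (card (phase_Z \<epsilon> u)) - real (card (phase_Z \<epsilon> w))\<bar>))"

definition is_minimizer ::
  "real \<Rightarrow> real \<Rightarrow> real \<Rightarrow> real \<Rightarrow> (real \<times> real \<Rightarrow> real) \<Rightarrow> (real \<times> real \<Rightarrow> real) \<Rightarrow> bool" where
  "is_minimizer k \<tau> \<gamma> \<epsilon> w v \<longleftrightarrow>
     v \<in> admissible \<epsilon> \<and> functional_F k \<tau> \<gamma> \<epsilon> v w < \<infinity> \<and>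
     (\<forall>u\<in>admissible \<epsilon>. functional_F k \<tau> \<gamma> \<epsilon> v w \<le> functional_F k \<tau> \<gamma> \<epsilon> u w)"

end

theory Submission imports Defs begin

text \<open>Changing a minimizer at a single site alters only the boundedly many bonds at that site,
  hence costs at most \<open>O(\<epsilon>)\<close> in energy, whereas it changes the penalty term by
  \<open>\<epsilon>\<^sup>\<gamma> / \<tau> = \<epsilon>\<^bsup>\<gamma>-1\<^esup> / \<zeta>\<close>, which dominates \<open>\<epsilon>\<close> because \<open>\<gamma> < 2\<close>. If there are too many zeros,
  turn one of them into \<open>-1\<close>: the phase \<open>I\<close> is unchanged. If there are too few, some zero \<open>p\<close> of
  the datum \<open>w\<close> is not yet a zero; set the value at \<open>p\<close> to \<open>0\<close>. As \<open>p\<close> is not in \<open>I\<^sub>w\<close>, this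
  does not increase the dissipation.\<close>

text \<open>Each coordinate difference is an integer multiple of \<epsilon> and is at most the
  Euclidean distance. The offsets in the box also include the diagonal ones and zero; this crude box
  suffices for counting bonds.\<close>

lemma lattice2_neighbour:
  assumes "0 < \<epsilon>" "p \<in> lattice2 \<epsilon>" "q \<in> lattice2 \<epsilon>" "dist p q = \<epsilon>"
  obtains i j :: int where "i \<in> {-1..1}" "j \<in> {-1..1}" "q = p + (\<epsilon> * of_int i, \<epsilon> * of_int j)"
proof -
  obtain a b :: int where p: "p = (\<epsilon> * of_int a, \<epsilon> * of_int b)"
    using assms(2) by (auto simp: lattice2_def)
  obtain c d :: int where q: "q = (\<epsilon> * of_int c, \<epsilon> * of_int d)"
    using assms(3) by (auto simp: lattice2_def)
  have "\<epsilon> * \<bar>real_of_int (c - a)\<bar> = dist (fst p) (fst q)"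
    using assms(1) by (simp add: p q dist_real_def abs_mult flip: right_diff_distrib)
  also have "\<dots> \<le> \<epsilon>" using dist_fst_le[of p q] assms(4) by simp
  finally have "\<bar>real_of_int (c - a)\<bar> \<le> 1" using assms(1) by simp
  then have i: "c - a \<in> {-1..1}" by (simp add: abs_le_iff)
  have "\<epsilon> * \<bar>real_of_int (d - b)\<bar> = dist (snd p) (snd q)"
    using assms(1) by (simp add: p q dist_real_def abs_mult flip: right_diff_distrib)
  also have "\<dots> \<le> \<epsilon>" using dist_snd_le[of p q] assms(4) by simp
  finally have "\<bar>real_of_int (d - b)\<bar> \<le> 1" using assms(1) by simp
  then have j: "d - b \<in> {-1..1}" by (simp add: abs_le_iff)
  show thesis
    by (rule that[OF i j]) (simp add: p q algebra_simps)
qed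

text \<open>Bonds at \<open>p\<close> are indexed by the offsets of the other endpoint. The 9 counts
  the whole 3 by 3 box rather than the four nearest neighbours; only a bound uniform in
  \<open>p\<close> and \<epsilon> matters.\<close>

lemma bonds_at_site:
  assumes "0 < \<epsilon>"
  shows "finite {e \<in> bonds \<epsilon>. p \<in> e}" and "card {e \<in> bonds \<epsilon>. p \<in> e} \<le> 9"
proof -
  let ?f = "\<lambda>(i::int, j::int). {p, p + (\<epsilon> * of_int i, \<epsilon> * of_int j)}"
  have sub: "{e \<in> bonds \<epsilon>. p \<in> e} \<subseteq> ?f ` ({-1..1} \<times> {-1..1})"
  proof
    fix e assume e: "e \<in> {e \<in> bonds \<epsilon>. p \<in> e}"
    \<comment> \<open>A bond is an unordered pair, so \<open>p\<close> may be either endpoint;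
      symmetry of \<open>dist\<close> covers both cases.\<close>
    then obtain q where q: "e = {p, q}" "p \<in> lattice2 \<epsilon>" "q \<in> lattice2 \<epsilon>" "dist p q = \<epsilon>"
      by (auto simp: bonds_def dist_commute insert_commute)
    show "e \<in> ?f ` ({-1..1} \<times> {-1..1})"
      using lattice2_neighbour[OF assms q(2-4)] q(1)
      by (metis (mono_tags, lifting) SigmaI case_prod_conv imageI)
  qed
  show "finite {e \<in> bonds \<epsilon>. p \<in> e}"
    using sub by (rule finite_subset) simp
  have "card {e \<in> bonds \<epsilon>. p \<in> e} \<le> card (?f ` ({-1..1} \<times> {-1..1}))"
    using sub by (intro card_mono) simp_all
  also have "\<dots> \<le> card ({-1..1::int} \<times> {-1..1::int})"
    by (rule card_image_le) simp
  finally show "card {e \<in> bonds \<epsilon>. p \<in> e} \<le> 9" by simp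
qed

lemma bond_energy_le:
  assumes "0 \<le> k" "0 \<le> \<epsilon>" "v \<in> admissible \<epsilon>" "e \<in> bonds \<epsilon>"
  shows "\<epsilon> * (1 - (\<Prod>p\<in>e. v p) - k * (1 - (\<Prod>p\<in>e. v p)\<^sup>2)) \<le> 2 * \<epsilon>"
proof -
  have "\<bar>v p\<bar> \<le> 1" if "p \<in> e" for p
  proof -
    have "p \<in> lattice2 \<epsilon>" using assms(4) that by (auto simp: bonds_def)
    then have "v p \<in> {-1, 0, 1}" using assms(3) by (auto simp: admissible_def)
    then show ?thesis by auto
  qed
  then have "\<bar>\<Prod>p\<in>e. v p\<bar> \<le> 1"
    by (simp add: abs_prod prod_le_1)
  then have "(\<Prod>p\<in>e. v p)\<^sup>2 \<le> 1" and "-1 \<le> (\<Prod>p\<in>e. v p)"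
    by (auto simp: abs_square_le_1)
  \<comment> \<open>The term with factor \<open>k\<close> is subtracted and nonnegative, so what
    remains is one minus the product, at most 2.\<close>
  then have "1 - (\<Prod>p\<in>e. v p) - k * (1 - (\<Prod>p\<in>e. v p)\<^sup>2) \<le> 2"
    using mult_nonneg_nonneg[OF assms(1), of "1 - (\<Prod>p\<in>e. v p)\<^sup>2"] by linarith
  then show ?thesis
    using assms(2) by (metis mult.commute mult_left_mono)
qed

text \<open>Bonds avoiding \<open>p\<close> keep their energy; each of the at most 9 bonds at
  \<open>p\<close> contributes at most \<open>2 * \<epsilon>\<close> afterwards, whence 18. The
  bound is additive, with no difference of energies, so it makes sense even when they are
  infinite.\<close>

lemma energy_single_site_le:
  assumes "0 \<le> k" "0 < \<epsilon>" "v \<in> admissible \<epsilon>" "\<And>q. q \<noteq> p \<Longrightarrow> v q = u q"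
  shows "energy k \<epsilon> v \<le> energy k \<epsilon> u + ennreal (18 * \<epsilon>)"
proof -
  define g where "g u e = ennreal (\<epsilon> * (1 - (\<Prod>p\<in>e. u p) - k * (1 - (\<Prod>p\<in>e. u p)\<^sup>2)))"
    for u :: "real \<times> real \<Rightarrow> real" and e
  define N where "N = {e \<in> bonds \<epsilon>. p \<in> e}"
  have N: "finite N" "card N \<le> 9" "N \<subseteq> bonds \<epsilon>"
    unfolding N_def using bonds_at_site[OF assms(2)] by auto
  have s: "h summable_on A" for h :: "(real \<times> real) set \<Rightarrow> ennreal" and A
    by (simp add: nonneg_summable_on_complete)
  have "energy k \<epsilon> v = infsum (g v) (N \<union> (bonds \<epsilon> - N))"
    unfolding energy_def g_def using N(3) by (simp add: Un_absorb1)
  also have "\<dots> = infsum (g v) N + infsum (g v) (bonds \<epsilon> - N)"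
    by (rule infsum_Un_disjoint[OF s s]) auto
  also have "infsum (g v) N \<le> ennreal (18 * \<epsilon>)"
  proof -
    have "infsum (g v) N = sum (g v) N" using N(1) by simp
    also have "\<dots> \<le> of_nat (card N) * ennreal (2 * \<epsilon>)"
    proof (rule sum_bounded_above)
      fix e assume "e \<in> N"
      then show "g v e \<le> ennreal (2 * \<epsilon>)"
        unfolding g_def using bond_energy_le[OF assms(1) _ assms(3)] N(3) assms(2)
        by (intro ennreal_leI) auto
    qed
    also have "\<dots> = ennreal (real (card N) * (2 * \<epsilon>))"
      using assms(2) by (simp add: ennreal_mult' ennreal_of_nat_eq_real_of_nat)
    also have "\<dots> \<le> ennreal (18 * \<epsilon>)"
      using N(2) assms(2) by (intro ennreal_leI) simp
    finally show ?thesis .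
  qed
  also have "infsum (g v) (bonds \<epsilon> - N) = infsum (g u) (bonds \<epsilon> - N)"
  proof (rule infsum_cong)
    fix e assume "e \<in> bonds \<epsilon> - N"
    then have "(\<Prod>q\<in>e. v q) = (\<Prod>q\<in>e. u q)"
      by (intro prod.cong) (auto simp: N_def intro!: assms(4))
    then show "g v e = g u e" by (simp add: g_def)
  qed
  \<comment> \<open>The old energy of the bonds at \<open>p\<close> is simply discarded, being
    nonnegative.\<close>
  also have "infsum (g u) (bonds \<epsilon> - N) \<le> energy k \<epsilon> u"
    unfolding energy_def g_def[symmetric] by (rule infsum_mono_neutral[OF s s]) auto
  finally show ?thesis
    by (simp add: add.commute add_left_mono)
qed

text \<open>The competitor \<open>v\<close> brings the number of zeros one unit closer to that of
  \<open>w\<close>, at an energy cost of at most \<open>18 * \<epsilon>\<close>. The two inclusions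
  in \<open>I\<close> say that the symmetric difference with \<open>phase_I \<epsilon> w\<close>
  does not grow, so the dissipation does not either.\<close>

lemma minimizer_penalty_gain_le:
  assumes "0 \<le> k" "0 < \<epsilon>" "0 < \<tau>"
    and min: "is_minimizer k \<tau> \<gamma> \<epsilon> w u"
    and v: "v \<in> admissible \<epsilon>" "\<And>q. q \<noteq> p \<Longrightarrow> v q = u q"
    and I: "phase_I \<epsilon> v - phase_I \<epsilon> w \<subseteq> phase_I \<epsilon> u" "phase_I \<epsilon> w \<inter> phase_I \<epsilon> u \<subseteq> phase_I \<epsilon> v"
    and Z: "\<bar>real (card (phase_Z \<epsilon> u)) - real (card (phase_Z \<epsilon> w))\<bar>
          = \<bar>real (card (phase_Z \<epsilon> v)) - real (card (phase_Z \<epsilon> w))\<bar> + 1"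
  shows "\<epsilon> powr \<gamma> / \<tau> \<le> 18 * \<epsilon>"
proof -
  define D where "D u = (\<Sum>\<^sub>\<infinity>p\<in>sym_diff (phase_I \<epsilon> u) (phase_I \<epsilon> w).
      ennreal (\<epsilon>\<^sup>2) * dist_bdry \<epsilon> p (phase_I \<epsilon> w))" for u
  define P where "P u = ennreal (\<epsilon> powr \<gamma> * \<bar>real (card (phase_Z \<epsilon> u)) - real (card (phase_Z \<epsilon> w))\<bar>)"
    for u
  have F: "functional_F k \<tau> \<gamma> \<epsilon> u w = energy k \<epsilon> u + ennreal (1 / \<tau>) * (D u + P u)" for u
    by (simp add: functional_F_def D_def P_def)
  have D: "D v \<le> D u"
    unfolding D_def using I
    by (intro infsum_mono_neutral) (auto simp: nonneg_summable_on_complete)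
  have P: "P u = P v + ennreal (\<epsilon> powr \<gamma>)"
    unfolding P_def Z by (simp add: distrib_left ennreal_plus)
  \<comment> \<open>\<open>?B\<close> is the part common to both sides of the comparison: old
    energy, old dissipation, new penalty.\<close>
  let ?B = "energy k \<epsilon> u + ennreal (1 / \<tau>) * (D u + P v)"
  have Fu: "functional_F k \<tau> \<gamma> \<epsilon> u w = ?B + ennreal (\<epsilon> powr \<gamma> / \<tau>)"
    unfolding F P using assms(3)
    by (simp add: distrib_left add.assoc ennreal_mult[symmetric])
  have "functional_F k \<tau> \<gamma> \<epsilon> u w \<le> functional_F k \<tau> \<gamma> \<epsilon> v w"
    using min v(1) by (simp add: is_minimizer_def)
  also have "\<dots> \<le> (energy k \<epsilon> u + ennreal (18 * \<epsilon>)) + ennreal (1 / \<tau>) * (D u + P v)"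
    unfolding F by (intro add_mono mult_left_mono order_refl D energy_single_site_le assms v) auto
  finally have "?B + ennreal (\<epsilon> powr \<gamma> / \<tau>) \<le> ?B + ennreal (18 * \<epsilon>)"
    by (simp add: Fu ac_simps)
  \<comment> \<open>Cancelling \<open>?B\<close> in \<open>ennreal\<close> requires it to be finite,
    which follows from the finite value at the minimizer.\<close>
  moreover have "?B < \<infinity>"
    using min unfolding is_minimizer_def Fu by simp
  ultimately have "ennreal (\<epsilon> powr \<gamma> / \<tau>) \<le> ennreal (18 * \<epsilon>)"
    by (metis ennreal_add_left_cancel_le infinity_ennreal_def less_irrefl)
  then show ?thesis
    using assms(2) by (simp add: ennreal_le_iff)
qed

lemma admissible_fun_upd:
  assumes "u \<in> admissible \<epsilon>" "p \<in> lattice2 \<epsilon>" "x \<in> {-1, 0, 1}"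
  shows "u(p := x) \<in> admissible \<epsilon>"
proof -
  have "phase_Z \<epsilon> (u(p := x)) \<subseteq> insert p (phase_Z \<epsilon> u)"
    by (auto simp: phase_Z_def)
  then have "finite (phase_Z \<epsilon> (u(p := x)))"
    using assms(1) by (auto simp: admissible_def intro: finite_subset)
  moreover have "u(p := x) \<in> lattice2 \<epsilon> \<rightarrow>\<^sub>E {-1, 0, 1}"
    using assms PiE_fun_upd[of x "\<lambda>_. {-1, 0, 1}" p u "lattice2 \<epsilon>"]
    by (simp add: admissible_def insert_absorb)
  ultimately show ?thesis by (simp add: admissible_def)
qed

lemma card_phase_Z_minimizer:
  assumes "0 \<le> k" "0 < \<epsilon>" "0 < \<tau>" "18 * \<epsilon> < \<epsilon> powr \<gamma> / \<tau>"
    and min: "is_minimizer k \<tau> \<gamma> \<epsilon> w u"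
  shows "card (phase_Z \<epsilon> u) = card (phase_Z \<epsilon> w)"
proof (rule ccontr)
  assume "card (phase_Z \<epsilon> u) \<noteq> card (phase_Z \<epsilon> w)"
  then consider "card (phase_Z \<epsilon> w) < card (phase_Z \<epsilon> u)" | "card (phase_Z \<epsilon> u) < card (phase_Z \<epsilon> w)"
    by linarith
  then show False
  proof cases
    case 1
    have u: "u \<in> admissible \<epsilon>" "finite (phase_Z \<epsilon> u)"
      using min by (auto simp: is_minimizer_def admissible_def)
    have "phase_Z \<epsilon> u \<noteq> {}" using 1 by auto
    then obtain p where p: "p \<in> phase_Z \<epsilon> u" by blast
    let ?v = "u(p := -1)"
    have Z: "phase_Z \<epsilon> ?v = phase_Z \<epsilon> u - {p}"
      by (auto simp: phase_Z_def)
    have "?v \<in> admissible \<epsilon>"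
      using u p by (intro admissible_fun_upd) (auto simp: phase_Z_def)
    moreover have "phase_I \<epsilon> ?v = phase_I \<epsilon> u"
      using p by (auto simp: phase_I_def phase_Z_def)
    moreover have "card (phase_Z \<epsilon> u) = Suc (card (phase_Z \<epsilon> ?v))"
      unfolding Z using u(2) p by (metis card.remove)
    ultimately have "\<epsilon> powr \<gamma> / \<tau> \<le> 18 * \<epsilon>"
      using 1 by (intro minimizer_penalty_gain_le[OF assms(1-3) min, of ?v p]) auto
    then show False using assms(4) by simp
  next
    case 2
    have u: "u \<in> admissible \<epsilon>" "finite (phase_Z \<epsilon> u)"
      using min by (auto simp: is_minimizer_def admissible_def)
    \<comment> \<open>An inclusion into the finite set of zeros of \<open>u\<close> would bound the
      cardinality the wrong way.\<close>
    have "\<not> phase_Z \<epsilon> w \<subseteq> phase_Z \<epsilon> u"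
      using 2 card_mono[OF u(2)] by (meson not_le)
    then obtain p where p: "p \<in> phase_Z \<epsilon> w" "p \<notin> phase_Z \<epsilon> u" by blast
    let ?v = "u(p := 0)"
    have Z: "phase_Z \<epsilon> ?v = insert p (phase_Z \<epsilon> u)"
      using p by (auto simp: phase_Z_def)
    have "?v \<in> admissible \<epsilon>"
      using u p by (intro admissible_fun_upd) (auto simp: phase_Z_def)
    \<comment> \<open>If \<open>u p = 1\<close>, the site \<open>p\<close> leaves the symmetric
      difference, as it lies outside \<open>phase_I \<epsilon> w\<close>; if
      \<open>u p = -1\<close>, the phase does not change.\<close>
    moreover have "phase_I \<epsilon> ?v - phase_I \<epsilon> w \<subseteq> phase_I \<epsilon> u"
      "phase_I \<epsilon> w \<inter> phase_I \<epsilon> u \<subseteq> phase_I \<epsilon> ?v"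
      using p by (auto simp: phase_I_def phase_Z_def)
    moreover have "card (phase_Z \<epsilon> ?v) = Suc (card (phase_Z \<epsilon> u))"
      unfolding Z using u(2) p by simp
    ultimately have "\<epsilon> powr \<gamma> / \<tau> \<le> 18 * \<epsilon>"
      using 2 by (intro minimizer_penalty_gain_le[OF assms(1-3) min, of ?v p]) auto
    then show False using assms(4) by simp
  qed
qed

theorem lemma5p1:
  fixes k \<zeta> \<gamma> :: real
    and u0 u1 :: "real \<Rightarrow> real \<times> real \<Rightarrow> real"
  assumes "1/3 < k" and "k < 1" and "0 < \<zeta>"
    and "0 < \<gamma>" and "\<gamma> < 2"
    and "\<And>\<epsilon>. 0 < \<epsilon> \<Longrightarrow> u0 \<epsilon> \<in> admissible \<epsilon>"
    and "\<And>\<epsilon>. 0 < \<epsilon> \<Longrightarrow> is_minimizer k (\<zeta> * \<epsilon>) \<gamma> \<epsilon> (u0 \<epsilon>) (u1 \<epsilon>)"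
  shows "\<exists>\<epsilon>b>0. \<forall>\<epsilon>. 0 < \<epsilon> \<and> \<epsilon> \<le> \<epsilon>b \<longrightarrow>
           card (phase_Z \<epsilon> (u1 \<epsilon>)) = card (phase_Z \<epsilon> (u0 \<epsilon>))"
proof (intro exI conjI allI impI)
  \<comment> \<open>Chosen so that \<open>?b powr (2 - \<gamma>)\<close> is half the critical value
    \<open>1 / (18 * \<zeta>)\<close>; the strict inequality then holds at
    \<open>\<epsilon> = ?b\<close> too.\<close>
  let ?b = "(1 / (36 * \<zeta>)) powr (1 / (2 - \<gamma>))"
  show "0 < ?b" using assms(3) by simp
  fix \<epsilon> :: real assume \<epsilon>: "0 < \<epsilon> \<and> \<epsilon> \<le> ?b"
  have "\<epsilon> powr (2 - \<gamma>) \<le> ?b powr (2 - \<gamma>)"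
    using \<epsilon> assms(5) by (intro powr_mono2) auto
  also have "\<dots> = 1 / (36 * \<zeta>)"
    using assms(3,5) by (simp add: powr_powr)
  also have "\<dots> < 1 / (18 * \<zeta>)"
    using assms(3) by (simp add: divide_simps)
  finally have "18 * \<zeta> * \<epsilon> powr (2 - \<gamma>) < 1"
    using assms(3) by (simp add: field_simps)
  then have "18 * \<zeta> * \<epsilon> powr (2 - \<gamma>) * \<epsilon> powr \<gamma> < \<epsilon> powr \<gamma>"
    using \<epsilon> by simp
  \<comment> \<open>The two powers multiply to the square of \<epsilon>, one factor of which belongs
    to the time step \<open>\<zeta> * \<epsilon>\<close>.\<close>
  also have "18 * \<zeta> * \<epsilon> powr (2 - \<gamma>) * \<epsilon> powr \<gamma> = 18 * \<epsilon> * (\<zeta> * \<epsilon>)"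
    using \<epsilon> by (simp add: mult.assoc power2_eq_square flip: powr_add)
  finally have "18 * \<epsilon> < \<epsilon> powr \<gamma> / (\<zeta> * \<epsilon>)"
    using \<epsilon> assms(3) by (simp add: field_simps)
  then show "card (phase_Z \<epsilon> (u1 \<epsilon>)) = card (phase_Z \<epsilon> (u0 \<epsilon>))"
    using card_phase_Z_minimizer[of k \<epsilon> "\<zeta> * \<epsilon>" \<gamma> "u0 \<epsilon>" "u1 \<epsilon>"] assms(1,3,7) \<epsilon> by simp
qed

end
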